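(* Let $\vdash_{HT}$ be a complete proof system for Hoare triples and $\vdash_{UHT}$ a complete proof system for under-approximate Hoare triples (both as defined in the context). If a Forall-Exist Hoare Tuple $\langle\Phi\rangle\,\overline{\chi_\forall}\sim\overline{\chi_\exists}\,\langle\Psi\rangle$ is valid, then it is derivable in Forall-Exist Hoare Logic (FEHL, the proof system given in the context, instantiated with $\vdash_{HT}$ and $\vdash_{UHT}$).
   Context: Programs. Fix a set $\mathcal{V}$ of program variables. Programs are generated by $\mathbb{P},\mathbb{Q} ::= \mathtt{skip} \mid x := e \mid \mathtt{assume}(b) \mid \mathtt{if}(b,\mathbb{P},\mathbb{Q}) \mid \mathtt{while}(b,\mathbb{P}) \mid \mathbb{P};\mathbb{Q} \mid x := \star$, where $x\in\mathcal{V}$, $e$ is a deterministic integer arithmetic expression and $b$ a deterministic Boolean expression. States are maps $\sigma:\mathcal{V}\to\mathbb{Z}$. The semantics $[\![\mathbb{P}]\!]$ is the smallest relation on states with: $[\![\mathtt{skip}]\!](\sigma,\sigma)$; $[\![x:=e]\!](\sigma,\sigma[x\mapsto e(\sigma)])$; $[\![x:=\star]\!](\sigma,\sigma[x\mapsto z])$ for every $z\in\mathbb{Z}$; $[\![\mathtt{assume}(b)]\!](\sigma,\sigma)$ if $b$ holds in $\sigma$; $[\![\mathbb{P};\mathbb{Q}]\!](\sigma,\sigma'')$ if $[\![\mathbb{P}]\!](\sigma,\sigma')$ and $[\![\mathbb{Q}]\!](\sigma',\sigma'')$; $[\![\mathtt{if}(b,\mathbb{P},\mathbb{Q})]\!](\sigma,\sigma')$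 if $b$ holds in $\sigma$ and $[\![\mathbb{P}]\!](\sigma,\sigma')$, or $b$ fails in $\sigma$ and $[\![\mathbb{Q}]\!](\sigma,\sigma')$; $[\![\mathtt{while}(b,\mathbb{P})]\!](\sigma,\sigma)$ if $b$ fails in $\sigma$; $[\![\mathtt{while}(b,\mathbb{P})]\!](\sigma,\sigma'')$ if $b$ holds in $\sigma$, $[\![\mathbb{P}]\!](\sigma,\sigma')$ and $[\![\mathtt{while}(b,\mathbb{P})]\!](\sigma',\sigma'')$. For $i\in\mathbb{N}$ let $\mathcal{V}_i=\{x_i : x\in\mathcal{V}\}$; a program over $\mathcal{V}_i$ uses only variables of $\mathcal{V}_i$, and on a state over a larger variable set it acts on the $\mathcal{V}_i$-part and leaves all other variables unchanged. For states with disjoint domains, $\sigma_1\oplus\sigma_2$ is the combined state. $\mathit{ModVars}(\mathbb{P})$ is the set of variables assigned (deterministically or nondeterministically) in $\mathbb{P}$; $\mathit{Vars}(e)$ is the set of variables of $e$. Assertions are first-order formulas over the relevant variables, interpreted over states; the background theory is assumed expressive enough that every set of states is expressible by an assertion. "$\Phi\Rightarrow\Psi$" as a premise means the implication is valid. A Hoare triple (HT) $\{\Phi\}\,\mathbb{P}\,\{\Psi\}$ is valid if for all $\sigma\models\Phi$ and all $\sigma'$ with $[\![\mathbb{P}]\!](\sigma,\sigma')$ we have $\sigma'\models\Psi$. An under-approximate Hoare triple (UHT) $\langle\Phi\rangle\,\mathbb{P}\,\langle\Psi\rangle$ is valid if for every $\sigma\models\Phi$ there exists $\sigma'$ with $[\![\mathbb{P}]\!](\sigma,\sigma')$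 and $\sigma'\models\Psi$. A proof system for such triples is complete if every valid triple is derivable. A Forall-Exist Hoare Tuple (FEHT) $\langle\Phi\rangle\,\mathbb{P}_1\circledast\cdots\circledast\mathbb{P}_k\sim\mathbb{P}_{k+1}\circledast\cdots\circledast\mathbb{P}_{k+l}\,\langle\Psi\rangle$ consists of assertions $\Phi,\Psi$ over $\bigcup_{i=1}^{k+l}\mathcal{V}_i$ and programs $\mathbb{P}_i$ over $\mathcal{V}_i$. It is valid if for all states $\sigma_1,\dots,\sigma_{k+l}$ (domains $\mathcal{V}_1,\dots,\mathcal{V}_{k+l}$) and $\sigma'_1,\dots,\sigma'_k$ with $\bigoplus_{i=1}^{k+l}\sigma_i\models\Phi$ and $[\![\mathbb{P}_i]\!](\sigma_i,\sigma'_i)$ for $i\in[1,k]$, there exist $\sigma'_{k+1},\dots,\sigma'_{k+l}$ with $[\![\mathbb{P}_i]\!](\sigma_i,\sigma'_i)$ for $i\in[k+1,k+l]$ and $\bigoplus_{i=1}^{k+l}\sigma'_i\models\Psi$. $\overline{\chi_\forall},\overline{\chi_\exists}$ denote (possibly empty) lists of programs joined by $\circledast$; $\epsilon$ is the empty list. FEHL consists of the following rules (judgments $\vdash\langle\Phi\rangle\,\overline{\chi_\forall}\sim\overline{\chi_\exists}\,\langle\Psi\rangle$; $\vdash\{\cdot\}\cdot\{\cdot\}$ and $\vdash\langle\cdot\rangle\cdot\langle\cdot\rangle$ refer to the given HT and UHT proof systems, applied on combined states). Rules marked "both sides" also exist in the analogous form for the existential list. (Reorder, both sides) from $\vdash\langle\Phi\rangle\,\overline{\chi_2}\circledast\overline{\chi_1}\sim\overline{\chi_\exists}\,\langle\Psi\rangle$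 infer $\vdash\langle\Phi\rangle\,\overline{\chi_1}\circledast\overline{\chi_2}\sim\overline{\chi_\exists}\,\langle\Psi\rangle$. (Skip-I, both sides) from $\vdash\langle\Phi\rangle\,\mathbb{P};\mathtt{skip}\circledast\overline{\chi_\forall}\sim\overline{\chi_\exists}\,\langle\Psi\rangle$ infer $\vdash\langle\Phi\rangle\,\mathbb{P}\circledast\overline{\chi_\forall}\sim\overline{\chi_\exists}\,\langle\Psi\rangle$. (Skip-E, both sides) from $\vdash\langle\Phi\rangle\,\overline{\chi_\forall}\sim\overline{\chi_\exists}\,\langle\Psi\rangle$ infer $\vdash\langle\Phi\rangle\,\mathtt{skip}\circledast\overline{\chi_\forall}\sim\overline{\chi_\exists}\,\langle\Psi\rangle$. (Done) $\vdash\langle\Phi\rangle\,\epsilon\sim\epsilon\,\langle\Phi\rangle$. (Cons) from $\Phi\Rightarrow\Phi'$, $\Psi'\Rightarrow\Psi$ and $\vdash\langle\Phi'\rangle\,\overline{\chi_\forall}\sim\overline{\chi_\exists}\,\langle\Psi'\rangle$ infer $\vdash\langle\Phi\rangle\,\overline{\chi_\forall}\sim\overline{\chi_\exists}\,\langle\Psi\rangle$. (If, both sides) from $\vdash\langle\Phi\wedge b\rangle\,\mathbb{P}_1;\mathbb{P}_3\circledast\overline{\chi_\forall}\sim\overline{\chi_\exists}\,\langle\Psi\rangle$ and $\vdash\langle\Phi\wedge\neg b\rangle\,\mathbb{P}_2;\mathbb{P}_3\circledast\overline{\chi_\forall}\sim\overline{\chi_\exists}\,\langle\Psi\rangle$ infer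 $\vdash\langle\Phi\rangle\,\mathtt{if}(b,\mathbb{P}_1,\mathbb{P}_2);\mathbb{P}_3\circledast\overline{\chi_\forall}\sim\overline{\chi_\exists}\,\langle\Psi\rangle$. (;-Assoc, both sides) from $\vdash\langle\Phi\rangle\,\mathbb{P}_1;(\mathbb{P}_2;\mathbb{P}_3)\circledast\overline{\chi_\forall}\sim\overline{\chi_\exists}\,\langle\Psi\rangle$ infer $\vdash\langle\Phi\rangle\,(\mathbb{P}_1;\mathbb{P}_2);\mathbb{P}_3\circledast\overline{\chi_\forall}\sim\overline{\chi_\exists}\,\langle\Psi\rangle$. ($\forall$-Step) from $\vdash\{\Phi\}\,\mathbb{P}_1\,\{\Phi'\}$ and $\vdash\langle\Phi'\rangle\,\mathbb{P}_2\circledast\overline{\chi_\forall}\sim\overline{\chi_\exists}\,\langle\Psi\rangle$ infer $\vdash\langle\Phi\rangle\,\mathbb{P}_1;\mathbb{P}_2\circledast\overline{\chi_\forall}\sim\overline{\chi_\exists}\,\langle\Psi\rangle$. ($\exists$-Step) from $\vdash\langle\Phi\rangle\,\mathbb{P}_1\,\langle\Phi'\rangle$ and $\vdash\langle\Phi'\rangle\,\overline{\chi_\forall}\sim\mathbb{P}_2\circledast\overline{\chi_\exists}\,\langle\Psi\rangle$ infer $\vdash\langle\Phi\rangle\,\overline{\chi_\forall}\sim\mathbb{P}_1;\mathbb{P}_2\circledast\overline{\chi_\exists}\,\langle\Psi\rangle$. ($\forall$-Assume) from $\vdash\langle\Phi\wedge b\rangle\,\mathbb{P}\circledast\overline{\chi_\forall}\sim\overline{\chi_\exists}\,\langle\Psi\rangle$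 infer $\vdash\langle\Phi\rangle\,\mathtt{assume}(b);\mathbb{P}\circledast\overline{\chi_\forall}\sim\overline{\chi_\exists}\,\langle\Psi\rangle$. ($\exists$-Assume) from $\Phi\Rightarrow b$ and $\vdash\langle\Phi\rangle\,\overline{\chi_\forall}\sim\mathbb{P}\circledast\overline{\chi_\exists}\,\langle\Psi\rangle$ infer $\vdash\langle\Phi\rangle\,\overline{\chi_\forall}\sim\mathtt{assume}(b);\mathbb{P}\circledast\overline{\chi_\exists}\,\langle\Psi\rangle$. ($\forall$-Choice) from $\vdash\langle\exists x.\Phi\rangle\,\mathbb{P}\circledast\overline{\chi_\forall}\sim\overline{\chi_\exists}\,\langle\Psi\rangle$ infer $\vdash\langle\Phi\rangle\,x:=\star;\mathbb{P}\circledast\overline{\chi_\forall}\sim\overline{\chi_\exists}\,\langle\Psi\rangle$. ($\exists$-Choice) from $x\notin\mathit{Vars}(e)$ and $\vdash\langle(\exists x.\Phi)\wedge x=e\rangle\,\overline{\chi_\forall}\sim\mathbb{P}\circledast\overline{\chi_\exists}\,\langle\Psi\rangle$ infer $\vdash\langle\Phi\rangle\,\overline{\chi_\forall}\sim x:=\star;\mathbb{P}\circledast\overline{\chi_\exists}\,\langle\Psi\rangle$. ($\forall$-Havoc) from $\vdash\langle\exists_{x\in\mathit{ModVars}(\mathbb{P})}x.\,\Phi\rangle\,\overline{\chi_\forall}\sim\overline{\chi_\exists}\,\langle\Psi\rangle$ infer $\vdash\langle\Phi\rangle\,\mathbb{P}\circledast\overline{\chi_\forall}\sim\overline{\chi_\exists}\,\langle\Psi\rangle$.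 ($\exists$-Havoc) from $\vdash\langle\Phi\rangle\,\mathbb{P}\,\langle\top\rangle$ and $\vdash\langle\exists_{x\in\mathit{ModVars}(\mathbb{P})}x.\,\Phi\rangle\,\overline{\chi_\forall}\sim\overline{\chi_\exists}\,\langle\Psi\rangle$ infer $\vdash\langle\Phi\rangle\,\overline{\chi_\forall}\sim\mathbb{P}\circledast\overline{\chi_\exists}\,\langle\Psi\rangle$. (Loop-Counting) Let $k\ge 1$, $l\ge0$, $B\ge1$, $c_1,\dots,c_{k+l}\in[1,B]$, and assertions $\mathbb{I}_1,\dots,\mathbb{I}_{B+1}$ with $\mathbb{I}=\mathbb{I}_1=\mathbb{I}_{B+1}$. If $\Phi\Rightarrow\mathbb{I}$, $\mathbb{I}\Rightarrow\bigwedge_{i=2}^{k+l}(b_1\leftrightarrow b_i)$, for every $j\in[1,B]$: $\vdash\langle\mathbb{I}_j\wedge\bigwedge_{i\in[1,k+l],c_i\ge j}b_i\rangle\,\circledast_{i\in[1,k],c_i\ge j}\mathbb{P}_i\sim\circledast_{i\in[k+1,k+l],c_i\ge j}\mathbb{P}_i\,\langle\mathbb{I}_{j+1}\wedge\bigwedge_{i\in[1,k+l],c_i>j}b_i\rangle$, and $\vdash\langle\mathbb{I}\wedge\bigwedge_{i=1}^{k+l}\neg b_i\rangle\,\mathbb{Q}_1\circledast\cdots\circledast\mathbb{Q}_k\circledast\overline{\chi_\forall}\sim\mathbb{Q}_{k+1}\circledast\cdots\circledast\mathbb{Q}_{k+l}\circledast\overline{\chi_\exists}\,\langle\Psi\rangle$,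 then infer $\vdash\langle\Phi\rangle\,\mathtt{while}(b_1,\mathbb{P}_1);\mathbb{Q}_1\circledast\cdots\circledast\mathtt{while}(b_k,\mathbb{P}_k);\mathbb{Q}_k\circledast\overline{\chi_\forall}\sim\mathtt{while}(b_{k+1},\mathbb{P}_{k+1});\mathbb{Q}_{k+1}\circledast\cdots\circledast\mathtt{while}(b_{k+l},\mathbb{P}_{k+l});\mathbb{Q}_{k+l}\circledast\overline{\chi_\exists}\,\langle\Psi\rangle$. *)

theory Defs
  imports Main "HOL-Library.FuncSet"
begin

type_synonym 'x state = "'x \<Rightarrow> int"
type_synonym 'x assertion = "'x state \<Rightarrow> bool"

text \<open>
  The language of deterministic integer and Boolean expressions is left open: it is an arbitrary
  pair of types of expressions, with their evaluation functions and their sets of variables.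
\<close>

record ('x, 'e, 'b) lang =
  aval :: "'e \<Rightarrow> 'x state \<Rightarrow> int"
  avars :: "'e \<Rightarrow> 'x set"
  bval :: "'b \<Rightarrow> 'x state \<Rightarrow> bool"
  bvars :: "'b \<Rightarrow> 'x set"

definition expr_lang :: "('x, 'e, 'b) lang \<Rightarrow> bool" where
  "expr_lang L \<longleftrightarrow>
     (\<forall>e. finite (avars L e)) \<and> (\<forall>b. finite (bvars L b)) \<and>
     (\<forall>e \<sigma> \<tau>. (\<forall>x\<in>avars L e. \<sigma> x = \<tau> x) \<longrightarrow> aval L e \<sigma> = aval L e \<tau>) \<and>
     (\<forall>b \<sigma> \<tau>. (\<forall>x\<in>bvars L b. \<sigma> x = \<tau> x) \<longrightarrow> bval L b \<sigma> = bval L b \<tau>)"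

datatype ('x, 'e, 'b) prog =
    Skip
  | Assign 'x 'e
  | Assume 'b
  | Ite 'b "('x, 'e, 'b) prog" "('x, 'e, 'b) prog"
  | While 'b "('x, 'e, 'b) prog"
  | Seq "('x, 'e, 'b) prog" "('x, 'e, 'b) prog"  (infixr \<open>;;\<close> 60)
  | Choose 'x

inductive sem :: "('x, 'e, 'b) lang \<Rightarrow> ('x, 'e, 'b) prog \<Rightarrow> 'x state \<Rightarrow> 'x state \<Rightarrow> bool"
  for L where
  Skip: "sem L Skip \<sigma> \<sigma>"
| Assign: "sem L (Assign x e) \<sigma> (\<sigma>(x := aval L e \<sigma>))"
| Choose: "sem L (Choose x) \<sigma> (\<sigma>(x := z))"
| Assume: "bval L b \<sigma> \<Longrightarrow> sem L (Assume b) \<sigma> \<sigma>"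
| Seq: "sem L P \<sigma> \<sigma>' \<Longrightarrow> sem L Q \<sigma>' \<sigma>'' \<Longrightarrow> sem L (P ;; Q) \<sigma> \<sigma>''"
| IteT: "bval L b \<sigma> \<Longrightarrow> sem L P \<sigma> \<sigma>' \<Longrightarrow> sem L (Ite b P Q) \<sigma> \<sigma>'"
| IteF: "\<not> bval L b \<sigma> \<Longrightarrow> sem L Q \<sigma> \<sigma>' \<Longrightarrow> sem L (Ite b P Q) \<sigma> \<sigma>'"
| WhileF: "\<not> bval L b \<sigma> \<Longrightarrow> sem L (While b P) \<sigma> \<sigma>"
| WhileT: "bval L b \<sigma> \<Longrightarrow> sem L P \<sigma> \<sigma>' \<Longrightarrow> sem L (While b P) \<sigma>' \<sigma>'' \<Longrightarrow>
    sem L (While b P) \<sigma> \<sigma>''"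

primrec mod_vars :: "('x, 'e, 'b) prog \<Rightarrow> 'x set" where
  "mod_vars Skip = {}"
| "mod_vars (Assign x e) = {x}"
| "mod_vars (Assume b) = {}"
| "mod_vars (Ite b P Q) = mod_vars P \<union> mod_vars Q"
| "mod_vars (While b P) = mod_vars P"
| "mod_vars (P ;; Q) = mod_vars P \<union> mod_vars Q"
| "mod_vars (Choose x) = {x}"

primrec prog_vars :: "('x, 'e, 'b) lang \<Rightarrow> ('x, 'e, 'b) prog \<Rightarrow> 'x set" where
  "prog_vars L Skip = {}"
| "prog_vars L (Assign x e) = insert x (avars L e)"
| "prog_vars L (Assume b) = bvars L b"
| "prog_vars L (Ite b P Q) = bvars L b \<union> prog_vars L P \<union> prog_vars L Q"
| "prog_vars L (While b P) = bvars L b \<union> prog_vars L P"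
| "prog_vars L (P ;; Q) = prog_vars L P \<union> prog_vars L Q"
| "prog_vars L (Choose x) = {x}"

text \<open>
  Every set of states is expressible, so assertions are predicates on states. An assertion over
  the variables \<open>D\<close> is one whose truth depends only on the values of the variables in \<open>D\<close>.
\<close>

definition assertion_over :: "'x set \<Rightarrow> 'x assertion \<Rightarrow> bool" where
  "assertion_over D \<Phi> \<longleftrightarrow> (\<forall>\<sigma> \<tau>. (\<forall>x\<in>D. \<sigma> x = \<tau> x) \<longrightarrow> \<Phi> \<sigma> = \<Phi> \<tau>)"

definition ex_vars :: "'x set \<Rightarrow> 'x assertion \<Rightarrow> 'x assertion" where
  "ex_vars X \<Phi> = (\<lambda>\<sigma>. \<exists>\<tau>. (\<forall>x. x \<notin> X \<longrightarrow> \<tau> x = \<sigma> x) \<and> \<Phi> \<tau>)"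

definition entails :: "'x assertion \<Rightarrow> 'x assertion \<Rightarrow> bool" where
  "entails \<Phi> \<Psi> \<longleftrightarrow> (\<forall>\<sigma>. \<Phi> \<sigma> \<longrightarrow> \<Psi> \<sigma>)"


type_synonym ('x, 'e, 'b) triple_system =
  "'x assertion \<Rightarrow> ('x, 'e, 'b) prog \<Rightarrow> 'x assertion \<Rightarrow> bool"

definition ht_valid :: "('x, 'e, 'b) lang \<Rightarrow> ('x, 'e, 'b) triple_system" where
  "ht_valid L \<Phi> P \<Psi> \<longleftrightarrow> (\<forall>\<sigma> \<sigma>'. \<Phi> \<sigma> \<longrightarrow> sem L P \<sigma> \<sigma>' \<longrightarrow> \<Psi> \<sigma>')"

definition uht_valid :: "('x, 'e, 'b) lang \<Rightarrow> ('x, 'e, 'b) triple_system" where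
  "uht_valid L \<Phi> P \<Psi> \<longleftrightarrow> (\<forall>\<sigma>. \<Phi> \<sigma> \<longrightarrow> (\<exists>\<sigma>'. sem L P \<sigma> \<sigma>' \<and> \<Psi> \<sigma>'))"

definition ht_complete :: "('x, 'e, 'b) lang \<Rightarrow> ('x, 'e, 'b) triple_system \<Rightarrow> bool" where
  "ht_complete L HT \<longleftrightarrow> (\<forall>\<Phi> P \<Psi>. ht_valid L \<Phi> P \<Psi> \<longrightarrow> HT \<Phi> P \<Psi>)"

definition uht_complete :: "('x, 'e, 'b) lang \<Rightarrow> ('x, 'e, 'b) triple_system \<Rightarrow> bool" where
  "uht_complete L UHT \<longleftrightarrow> (\<forall>\<Phi> P \<Psi>. uht_valid L \<Phi> P \<Psi> \<longrightarrow> UHT \<Phi> P \<Psi>)"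


text \<open>The indexed variable \<open>x\<^sub>i\<close> is the pair \<open>(x, i)\<close>.\<close>

definition vars_copy :: "nat \<Rightarrow> ('v \<times> nat) set" where
  "vars_copy i = UNIV \<times> {i}"

definition vars_upto :: "nat \<Rightarrow> ('v \<times> nat) set" where
  "vars_upto n = (\<Union>i\<in>{1..n}. vars_copy i)"

text \<open>
  A state with domain \<open>D\<close> is a function that is \<^const>\<open>undefined\<close> outside \<open>D\<close>. Programs over
  \<open>vars_copy i\<close> change only variables in \<open>vars_copy i\<close>, so \<^const>\<open>sem\<close> on such states is the
  semantics on states with domain \<open>vars_copy i\<close>.
\<close>

definition states_on :: "'x set \<Rightarrow> 'x state set" where
  "states_on D = D \<rightarrow>\<^sub>E UNIV"

definition combine :: "nat \<Rightarrow> (nat \<Rightarrow> ('v \<times> nat) state) \<Rightarrow> ('v \<times> nat) state" where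
  "combine n \<sigma> = (\<lambda>v\<in>vars_upto n. \<sigma> (snd v) v)"

definition is_feht :: "('v \<times> nat, 'e, 'b) lang \<Rightarrow> ('v \<times> nat) assertion \<Rightarrow>
    ('v \<times> nat, 'e, 'b) prog list \<Rightarrow> ('v \<times> nat, 'e, 'b) prog list \<Rightarrow> ('v \<times> nat) assertion \<Rightarrow> bool"
  where
  "is_feht L \<Phi> \<chi>A \<chi>E \<Psi> \<longleftrightarrow>
     (let n = length \<chi>A + length \<chi>E in
        assertion_over (vars_upto n) \<Phi> \<and> assertion_over (vars_upto n) \<Psi> \<and>
        (\<forall>i\<in>{1..n}. prog_vars L ((\<chi>A @ \<chi>E) ! (i - 1)) \<subseteq> vars_copy i))"

definition feht_valid :: "('v \<times> nat, 'e, 'b) lang \<Rightarrow> ('v \<times> nat) assertion \<Rightarrow>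
    ('v \<times> nat, 'e, 'b) prog list \<Rightarrow> ('v \<times> nat, 'e, 'b) prog list \<Rightarrow> ('v \<times> nat) assertion \<Rightarrow> bool"
  where
  "feht_valid L \<Phi> \<chi>A \<chi>E \<Psi> \<longleftrightarrow>
     (let k = length \<chi>A; l = length \<chi>E; P = (\<lambda>i. (\<chi>A @ \<chi>E) ! (i - 1)) in
        \<forall>\<sigma> \<sigma>'.
          (\<forall>i\<in>{1..k + l}. \<sigma> i \<in> states_on (vars_copy i)) \<longrightarrow>
          (\<forall>i\<in>{1..k}. \<sigma>' i \<in> states_on (vars_copy i)) \<longrightarrow>
          \<Phi> (combine (k + l) \<sigma>) \<longrightarrow>
          (\<forall>i\<in>{1..k}. sem L (P i) (\<sigma> i) (\<sigma>' i)) \<longrightarrow>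
          (\<exists>\<tau>. (\<forall>i\<in>{k + 1..k + l}. \<tau> i \<in> states_on (vars_copy i)) \<and>
               (\<forall>i\<in>{k + 1..k + l}. sem L (P i) (\<sigma> i) (\<tau> i)) \<and>
               \<Psi> (combine (k + l) (\<lambda>i. if i \<le> k then \<sigma>' i else \<tau> i))))"

text \<open>
  \<open>D\<close> is the set of variables over which the assertions of a derivation range: the variables of
  the tuple being derived, which stay in scope when a rule drops one of its programs. Read from
  conclusion to premises, no rule introduces new program variables, so restricting the assertions
  and expressions that occur only in the premises keeps every judgment of a derivation over \<open>D\<close>
  if the derived tuple is.
\<close>

inductive fehl :: "('x, 'e, 'b) lang \<Rightarrow> ('x, 'e, 'b) triple_system \<Rightarrow> ('x, 'e, 'b) triple_system \<Rightarrow>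
    'x set \<Rightarrow> 'x assertion \<Rightarrow> ('x, 'e, 'b) prog list \<Rightarrow> ('x, 'e, 'b) prog list \<Rightarrow> 'x assertion \<Rightarrow> bool"
  for L HT UHT D where
  ReorderA:
    "fehl L HT UHT D \<Phi> (\<chi>2 @ \<chi>1) \<chi>E \<Psi> \<Longrightarrow> fehl L HT UHT D \<Phi> (\<chi>1 @ \<chi>2) \<chi>E \<Psi>"
| ReorderE:
    "fehl L HT UHT D \<Phi> \<chi>A (\<chi>2 @ \<chi>1) \<Psi> \<Longrightarrow> fehl L HT UHT D \<Phi> \<chi>A (\<chi>1 @ \<chi>2) \<Psi>"
| SkipIA:
    "fehl L HT UHT D \<Phi> ((P ;; Skip) # \<chi>A) \<chi>E \<Psi> \<Longrightarrow> fehl L HT UHT D \<Phi> (P # \<chi>A) \<chi>E \<Psi>"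
| SkipIE:
    "fehl L HT UHT D \<Phi> \<chi>A ((P ;; Skip) # \<chi>E) \<Psi> \<Longrightarrow> fehl L HT UHT D \<Phi> \<chi>A (P # \<chi>E) \<Psi>"
| SkipEA:
    "fehl L HT UHT D \<Phi> \<chi>A \<chi>E \<Psi> \<Longrightarrow> fehl L HT UHT D \<Phi> (Skip # \<chi>A) \<chi>E \<Psi>"
| SkipEE:
    "fehl L HT UHT D \<Phi> \<chi>A \<chi>E \<Psi> \<Longrightarrow> fehl L HT UHT D \<Phi> \<chi>A (Skip # \<chi>E) \<Psi>"
| Done:
    "fehl L HT UHT D \<Phi> [] [] \<Phi>"
| Cons:
    "\<lbrakk>assertion_over D \<Phi>'; assertion_over D \<Psi>'; entails \<Phi> \<Phi>'; entails \<Psi>' \<Psi>;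
      fehl L HT UHT D \<Phi>' \<chi>A \<chi>E \<Psi>'\<rbrakk>
     \<Longrightarrow> fehl L HT UHT D \<Phi> \<chi>A \<chi>E \<Psi>"
| IfA:
    "\<lbrakk>fehl L HT UHT D (\<lambda>\<sigma>. \<Phi> \<sigma> \<and> bval L b \<sigma>) ((P1 ;; P3) # \<chi>A) \<chi>E \<Psi>;
      fehl L HT UHT D (\<lambda>\<sigma>. \<Phi> \<sigma> \<and> \<not> bval L b \<sigma>) ((P2 ;; P3) # \<chi>A) \<chi>E \<Psi>\<rbrakk>
     \<Longrightarrow> fehl L HT UHT D \<Phi> ((Ite b P1 P2 ;; P3) # \<chi>A) \<chi>E \<Psi>"
| IfE:
    "\<lbrakk>fehl L HT UHT D (\<lambda>\<sigma>. \<Phi> \<sigma> \<and> bval L b \<sigma>) \<chi>A ((P1 ;; P3) # \<chi>E) \<Psi>;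
      fehl L HT UHT D (\<lambda>\<sigma>. \<Phi> \<sigma> \<and> \<not> bval L b \<sigma>) \<chi>A ((P2 ;; P3) # \<chi>E) \<Psi>\<rbrakk>
     \<Longrightarrow> fehl L HT UHT D \<Phi> \<chi>A ((Ite b P1 P2 ;; P3) # \<chi>E) \<Psi>"
| AssocA:
    "fehl L HT UHT D \<Phi> ((P1 ;; (P2 ;; P3)) # \<chi>A) \<chi>E \<Psi>
     \<Longrightarrow> fehl L HT UHT D \<Phi> (((P1 ;; P2) ;; P3) # \<chi>A) \<chi>E \<Psi>"
| AssocE:
    "fehl L HT UHT D \<Phi> \<chi>A ((P1 ;; (P2 ;; P3)) # \<chi>E) \<Psi>
     \<Longrightarrow> fehl L HT UHT D \<Phi> \<chi>A (((P1 ;; P2) ;; P3) # \<chi>E) \<Psi>"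
| StepA:
    "\<lbrakk>assertion_over D \<Phi>'; HT \<Phi> P1 \<Phi>'; fehl L HT UHT D \<Phi>' (P2 # \<chi>A) \<chi>E \<Psi>\<rbrakk>
     \<Longrightarrow> fehl L HT UHT D \<Phi> ((P1 ;; P2) # \<chi>A) \<chi>E \<Psi>"
| StepE:
    "\<lbrakk>assertion_over D \<Phi>'; UHT \<Phi> P1 \<Phi>'; fehl L HT UHT D \<Phi>' \<chi>A (P2 # \<chi>E) \<Psi>\<rbrakk>
     \<Longrightarrow> fehl L HT UHT D \<Phi> \<chi>A ((P1 ;; P2) # \<chi>E) \<Psi>"
| AssumeA:
    "fehl L HT UHT D (\<lambda>\<sigma>. \<Phi> \<sigma> \<and> bval L b \<sigma>) (P # \<chi>A) \<chi>E \<Psi>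
     \<Longrightarrow> fehl L HT UHT D \<Phi> ((Assume b ;; P) # \<chi>A) \<chi>E \<Psi>"
| AssumeE:
    "\<lbrakk>entails \<Phi> (bval L b); fehl L HT UHT D \<Phi> \<chi>A (P # \<chi>E) \<Psi>\<rbrakk>
     \<Longrightarrow> fehl L HT UHT D \<Phi> \<chi>A ((Assume b ;; P) # \<chi>E) \<Psi>"
| ChoiceA:
    "fehl L HT UHT D (ex_vars {x} \<Phi>) (P # \<chi>A) \<chi>E \<Psi>
     \<Longrightarrow> fehl L HT UHT D \<Phi> ((Choose x ;; P) # \<chi>A) \<chi>E \<Psi>"
| ChoiceE:
    "\<lbrakk>avars L e \<subseteq> D; x \<notin> avars L e;
      fehl L HT UHT D (\<lambda>\<sigma>. ex_vars {x} \<Phi> \<sigma> \<and> \<sigma> x = aval L e \<sigma>) \<chi>A (P # \<chi>E) \<Psi>\<rbrakk>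
     \<Longrightarrow> fehl L HT UHT D \<Phi> \<chi>A ((Choose x ;; P) # \<chi>E) \<Psi>"
| HavocA:
    "fehl L HT UHT D (ex_vars (mod_vars P) \<Phi>) \<chi>A \<chi>E \<Psi>
     \<Longrightarrow> fehl L HT UHT D \<Phi> (P # \<chi>A) \<chi>E \<Psi>"
| HavocE:
    "\<lbrakk>UHT \<Phi> P (\<lambda>_. True); fehl L HT UHT D (ex_vars (mod_vars P) \<Phi>) \<chi>A \<chi>E \<Psi>\<rbrakk>
     \<Longrightarrow> fehl L HT UHT D \<Phi> \<chi>A (P # \<chi>E) \<Psi>"
| LoopCounting:
    "\<lbrakk>1 \<le> k; 1 \<le> (B :: nat); \<forall>i\<in>{1..k + l}. c i \<in> {1..B};
      \<forall>j\<in>{1..B + 1}. assertion_over D (I j); I 1 = I (B + 1);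
      entails \<Phi> (I 1);
      entails (I 1) (\<lambda>\<sigma>. \<forall>i\<in>{2..k + l}. bval L (b 1) \<sigma> \<longleftrightarrow> bval L (b i) \<sigma>);
      \<And>j. j \<in> {1..B} \<Longrightarrow>
        fehl L HT UHT D
          (\<lambda>\<sigma>. I j \<sigma> \<and> (\<forall>i\<in>{1..k + l}. c i \<ge> j \<longrightarrow> bval L (b i) \<sigma>))
          (map P (filter (\<lambda>i. c i \<ge> j) [1..<k + 1]))
          (map P (filter (\<lambda>i. c i \<ge> j) [k + 1..<k + l + 1]))
          (\<lambda>\<sigma>. I (j + 1) \<sigma> \<and> (\<forall>i\<in>{1..k + l}. c i > j \<longrightarrow> bval L (b i) \<sigma>));
      fehl L HT UHT D
        (\<lambda>\<sigma>. I 1 \<sigma> \<and> (\<forall>i\<in>{1..k + l}. \<not> bval L (b i) \<sigma>))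
        (map Q [1..<k + 1] @ \<chi>A)
        (map Q [k + 1..<k + l + 1] @ \<chi>E)
        \<Psi>\<rbrakk>
     \<Longrightarrow> fehl L HT UHT D \<Phi>
           (map (\<lambda>i. While (b i) (P i) ;; Q i) [1..<k + 1] @ \<chi>A)
           (map (\<lambda>i. While (b i) (P i) ;; Q i) [k + 1..<k + l + 1] @ \<chi>E)
           \<Psi>"

end

theory Submission
  imports Defs "HOL-Library.Disjoint_Sets"
begin

text \<open>
  Programs over disjoint sets of variables commute, so a tuple is valid iff from every state
  satisfying the precondition, running the universal programs one after the other on the combined
  state only leads to states from which the existential programs, run one after the other, can
  reach the postcondition. Such a sequential statement is derivable by peeling off one program at
  a time with a single HT or UHT step, with the weakest precondition of the remaining programs as
  intermediate assertion.
\<close>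

section \<open>Locality of the program semantics\<close>

lemma sem_unmodified:
  assumes "sem L P \<sigma> \<sigma>'" "x \<notin> prog_vars L P"
  shows "\<sigma>' x = \<sigma> x"
  using assms by induction auto

text \<open>Expressions of \<open>P\<close> read only \<open>D\<close>, and updates inside
  \<open>D\<close> commute with \<open>override_on\<close>, so an execution can be replayed with any
  frame \<open>\<rho>\<close> outside \<open>D\<close>. This serves both to project a run to one
  component and to lift a component execution to the full state.\<close>

lemma sem_override_on:
  assumes "expr_lang L" "sem L P \<sigma> \<sigma>'" "prog_vars L P \<subseteq> D"
  shows "sem L P (override_on \<rho> \<sigma> D) (override_on \<rho> \<sigma>' D)"
proof -
  have a: "aval L e (override_on \<rho> \<sigma> D) = aval L e \<sigma>" if "avars L e \<subseteq> D" for e \<sigma>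
    using assms(1) that unfolding expr_lang_def
    by (metis override_on_apply_in subsetD)
  have b: "bval L b (override_on \<rho> \<sigma> D) = bval L b \<sigma>" if "bvars L b \<subseteq> D" for b \<sigma>
    using assms(1) that unfolding expr_lang_def
    by (metis override_on_apply_in subsetD)
  have upd: "override_on \<rho> (\<sigma>(x := z)) D = (override_on \<rho> \<sigma> D)(x := z)" if "x \<in> D" for \<sigma> x z
    using that by (auto simp: override_on_def)
  from assms(2,3) show ?thesis
  proof induction
    case (Assign x e \<sigma>)
    then show ?case
      using sem.Assign[of L x e "override_on \<rho> \<sigma> D"] by (simp add: upd a del: fun_upd_apply)
  next
    case (WhileT b \<sigma> P \<sigma>' \<sigma>'')
    then show ?case
      by (auto intro: sem.WhileT simp: b)
  qed (auto intro: sem.intros simp: upd b simp del: fun_upd_apply)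
qed

section \<open>Running programs over disjoint variable sets one after the other\<close>

primrec runs ::
  "('x, 'e, 'b) lang \<Rightarrow> ('x, 'e, 'b) prog list \<Rightarrow> 'x state \<Rightarrow> 'x state \<Rightarrow> bool" where
  "runs L [] \<sigma> \<sigma>' \<longleftrightarrow> \<sigma>' = \<sigma>"
| "runs L (P # Ps) \<sigma> \<sigma>' \<longleftrightarrow> (\<exists>\<rho>. sem L P \<sigma> \<rho> \<and> runs L Ps \<rho> \<sigma>')"

lemma runs_unmodified:
  assumes "runs L Ps \<sigma> \<sigma>'" "\<And>P. P \<in> set Ps \<Longrightarrow> x \<notin> prog_vars L P"
  shows "\<sigma>' x = \<sigma> x"
  using assms
proof (induction Ps arbitrary: \<sigma>)
  case (Cons P Ps)
  then obtain \<rho> where "sem L P \<sigma> \<rho>" "runs L Ps \<rho> \<sigma>'"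
    by auto
  with Cons show ?case
    by (metis list.set_intros sem_unmodified)
qed simp

lemma runs_override_on:
  assumes "expr_lang L" "runs L Ps \<sigma> \<sigma>'" "\<And>P. P \<in> set Ps \<Longrightarrow> prog_vars L P \<subseteq> D"
  shows "runs L Ps (override_on \<rho> \<sigma> D) (override_on \<rho> \<sigma>' D)"
  using assms(2,3)
proof (induction Ps arbitrary: \<sigma>)
  case (Cons P Ps)
  then obtain \<sigma>1 where "sem L P \<sigma> \<sigma>1" "runs L Ps \<sigma>1 \<sigma>'"
    by auto
  with Cons show ?case
    using sem_override_on[OF assms(1), of P \<sigma> \<sigma>1 D \<rho>] by auto
qed simp

text \<open>Only the program at position \<open>j\<close> touches \<open>C (m + j)\<close>, so
  projecting a run to that component leaves just its execution. The offset \<open>m\<close> is free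
  because the tail of the list starts one component later.\<close>

lemma runs_components:
  assumes "expr_lang L" "disjoint_family C" "runs L Ps \<sigma> \<sigma>'"
    and "\<And>j. j < length Ps \<Longrightarrow> prog_vars L (Ps ! j) \<subseteq> C (m + j)" "j < length Ps"
  shows "sem L (Ps ! j) (override_on \<rho> \<sigma> (C (m + j))) (override_on \<rho> \<sigma>' (C (m + j)))"
  using assms(3-5)
proof (induction Ps arbitrary: \<sigma> m j)
  case (Cons P Ps)
  then obtain \<sigma>1 where \<sigma>1: "sem L P \<sigma> \<sigma>1" "runs L Ps \<sigma>1 \<sigma>'"
    by auto
  have P: "prog_vars L P \<subseteq> C m"
    using Cons.prems(2)[of 0] by simp
  have Ps: "prog_vars L (Ps ! i) \<subseteq> C (Suc m + i)" if "i < length Ps" for i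
    using Cons.prems(2)[of "Suc i"] that by simp
  have disj: "x \<notin> C i" if "x \<in> C j" "i \<noteq> j" for x i j
    using that assms(2) by (auto simp: disjoint_family_on_def)
  show ?case
  proof (cases j)
    case 0
    \<comment> \<open>The programs after \<open>P\<close> live in other components, so
      \<open>C m\<close> is final once \<open>P\<close> has run.\<close>
    have "\<sigma>' x = \<sigma>1 x" if x: "x \<in> C m" for x
    proof (rule runs_unmodified[OF \<sigma>1(2)])
      fix Q assume "Q \<in> set Ps"
      then obtain i where "i < length Ps" "Q = Ps ! i"
        by (metis in_set_conv_nth)
      then show "x \<notin> prog_vars L Q"
        using Ps disj[OF x, of "Suc m + i"] by fastforce
    qed
    then have "override_on \<rho> \<sigma>' (C m) = override_on \<rho> \<sigma>1 (C m)"
      by (auto simp: override_on_def)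
    with 0 show ?thesis
      using sem_override_on[OF assms(1) \<sigma>1(1) P] by simp
  next
    case (Suc i)
    have "\<sigma>1 x = \<sigma> x" if "x \<in> C (m + j)" for x
      using sem_unmodified[OF \<sigma>1(1)] P disj[OF that, of m] Suc by auto
    then have "override_on \<rho> \<sigma> (C (m + j)) = override_on \<rho> \<sigma>1 (C (m + j))"
      by (auto simp: override_on_def)
    with Cons.IH[OF \<sigma>1(2) Ps, of i] Suc Cons.prems(3) show ?thesis
      by simp
  qed
qed simp

text \<open>Converse of \<open>runs_components\<close>: independent executions glue into one run,
  since no program disturbs the component from which another one starts or the result that it
  leaves.\<close>

lemma runs_of_components:
  assumes "expr_lang L" "disjoint_family C"
    and "\<And>j. j < length Ps \<Longrightarrow> prog_vars L (Ps ! j) \<subseteq> C (m + j)"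
    and "\<And>j. j < length Ps \<Longrightarrow> sem L (Ps ! j) (override_on \<rho> \<sigma> (C (m + j))) (\<tau> (m + j))"
  shows "\<exists>\<sigma>'. runs L Ps \<sigma> \<sigma>' \<and> (\<forall>j<length Ps. \<forall>x\<in>C (m + j). \<sigma>' x = \<tau> (m + j) x)"
  using assms(3-)
proof (induction Ps arbitrary: \<sigma> m)
  case (Cons P Ps)
  have P: "prog_vars L P \<subseteq> C m"
    using Cons.prems(1)[of 0] by simp
  have Ps: "prog_vars L (Ps ! i) \<subseteq> C (Suc m + i)" if "i < length Ps" for i
    using Cons.prems(1)[of "Suc i"] that by simp
  have disj: "x \<notin> C i" if "x \<in> C j" "i \<noteq> j" for x i j
    using that assms(2) by (auto simp: disjoint_family_on_def)
  define \<sigma>1 where "\<sigma>1 = override_on \<sigma> (\<tau> m) (C m)"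
  \<comment> \<open>Exchanging the frame \<open>\<rho>\<close> for \<open>\<sigma>\<close> gives
    back \<open>\<sigma>\<close> itself, so the execution given for the first component lifts to one
    from \<open>\<sigma>\<close> to \<open>\<sigma>1\<close>.\<close>
  have "override_on \<sigma> (override_on \<rho> \<sigma> (C m)) (C m) = \<sigma>"
    by (auto simp: override_on_def)
  then have 1: "sem L P \<sigma> \<sigma>1"
    using sem_override_on[OF assms(1) _ P, of "override_on \<rho> \<sigma> (C m)" "\<tau> m" \<sigma>] Cons.prems(2)[of 0]
    by (simp add: \<sigma>1_def)
  have same: "override_on \<rho> \<sigma>1 (C (Suc m + i)) = override_on \<rho> \<sigma> (C (Suc m + i))" for i
    using disj[of _ "Suc m + i" m] by (auto simp: override_on_def \<sigma>1_def)
  have "\<exists>\<sigma>'. runs L Ps \<sigma>1 \<sigma>' \<and>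
      (\<forall>j<length Ps. \<forall>x\<in>C (Suc m + j). \<sigma>' x = \<tau> (Suc m + j) x)"
  proof (rule Cons.IH[OF Ps])
    fix j assume "j < length Ps"
    then show "sem L (Ps ! j) (override_on \<rho> \<sigma>1 (C (Suc m + j))) (\<tau> (Suc m + j))"
      using Cons.prems(2)[of "Suc j"] unfolding same by simp
  qed
  then obtain \<sigma>' where 2: "runs L Ps \<sigma>1 \<sigma>'"
    "\<And>j x. j < length Ps \<Longrightarrow> x \<in> C (Suc m + j) \<Longrightarrow> \<sigma>' x = \<tau> (Suc m + j) x"
    by blast
  have 3: "\<sigma>' x = \<tau> m x" if x: "x \<in> C m" for x
  proof -
    have "\<sigma>' x = \<sigma>1 x"
    proof (rule runs_unmodified[OF 2(1)])
      fix Q assume "Q \<in> set Ps"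
      then obtain i where "i < length Ps" "Q = Ps ! i"
        by (metis in_set_conv_nth)
      then show "x \<notin> prog_vars L Q"
        using Ps disj[OF x, of "Suc m + i"] by fastforce
    qed
    with x show ?thesis
      by (simp add: \<sigma>1_def)
  qed
  have "\<sigma>' x = \<tau> (m + j) x" if "j < length (P # Ps)" "x \<in> C (m + j)" for j x
    using that 2(2) 3 by (cases j) auto
  with 1 2(1) show ?case
    by auto
qed simp

section \<open>Semantic weakest preconditions and the variables they depend on\<close>

definition wp_runs ::
  "('x, 'e, 'b) lang \<Rightarrow> ('x, 'e, 'b) prog list \<Rightarrow> 'x assertion \<Rightarrow> 'x assertion" where
  "wp_runs L Ps \<Psi> = (\<lambda>\<sigma>. \<exists>\<sigma>'. runs L Ps \<sigma> \<sigma>' \<and> \<Psi> \<sigma>')"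

definition wlp_runs ::
  "('x, 'e, 'b) lang \<Rightarrow> ('x, 'e, 'b) prog list \<Rightarrow> 'x assertion \<Rightarrow> 'x assertion" where
  "wlp_runs L Ps \<Psi> = (\<lambda>\<sigma>. \<forall>\<sigma>'. runs L Ps \<sigma> \<sigma>' \<longrightarrow> \<Psi> \<sigma>')"

text \<open>Supplies the side condition on intermediate assertions in the step rules. If
  \<open>\<sigma>\<close> and \<open>\<tau>\<close> agree on \<open>D\<close>, a run from
  \<open>\<sigma>\<close> is replayed from \<open>\<tau>\<close> by changing its frame outside
  \<open>D\<close>, which \<open>\<Psi>\<close> does not see.\<close>

lemma assertion_over_wp_runs:
  assumes "expr_lang L" "\<And>P. P \<in> set Ps \<Longrightarrow> prog_vars L P \<subseteq> D" "assertion_over D \<Psi>"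
  shows "assertion_over D (wp_runs L Ps \<Psi>)"
proof -
  have "wp_runs L Ps \<Psi> \<tau>" if "wp_runs L Ps \<Psi> \<sigma>" and eq: "\<forall>x\<in>D. \<sigma> x = \<tau> x" for \<sigma> \<tau>
  proof -
    from that(1) obtain \<sigma>' where \<sigma>': "runs L Ps \<sigma> \<sigma>'" "\<Psi> \<sigma>'"
      by (auto simp: wp_runs_def)
    have "override_on \<tau> \<sigma> D = \<tau>"
      using eq by (auto simp: override_on_def)
    with runs_override_on[OF assms(1) \<sigma>'(1) assms(2), of \<tau>]
    have "runs L Ps \<tau> (override_on \<tau> \<sigma>' D)"
      by simp
    moreover have "\<Psi> (override_on \<tau> \<sigma>' D)"
      using assms(3) \<sigma>'(2) unfolding assertion_over_def by (metis override_on_apply_in)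
    ultimately show ?thesis
      by (auto simp: wp_runs_def)
  qed
  then show ?thesis
    unfolding assertion_over_def by metis
qed

text \<open>Follows by duality: \<open>wlp_runs\<close> is the negation of \<open>wp_runs\<close>
  for the negated postcondition.\<close>

lemma assertion_over_wlp_runs:
  assumes "expr_lang L" "\<And>P. P \<in> set Ps \<Longrightarrow> prog_vars L P \<subseteq> D" "assertion_over D \<Psi>"
  shows "assertion_over D (wlp_runs L Ps \<Psi>)"
proof -
  have "assertion_over D (wp_runs L Ps (\<lambda>\<sigma>. \<not> \<Psi> \<sigma>))"
    using assms by (intro assertion_over_wp_runs) (auto simp: assertion_over_def)
  moreover have "wlp_runs L Ps \<Psi> = (\<lambda>\<sigma>. \<not> wp_runs L Ps (\<lambda>\<sigma>. \<not> \<Psi> \<sigma>) \<sigma>)"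
    by (simp add: wp_runs_def wlp_runs_def)
  ultimately show ?thesis
    by (simp add: assertion_over_def)
qed

section \<open>Derivations for sequential statements\<close>

lemma fehl_existential:
  assumes "expr_lang L" "uht_complete L UHT"
    and "\<And>P. P \<in> set \<chi>E \<Longrightarrow> prog_vars L P \<subseteq> D" "assertion_over D \<Psi>"
    and "entails \<Phi> (wp_runs L \<chi>E \<Psi>)"
  shows "fehl L HT UHT D \<Phi> [] \<chi>E \<Psi>"
  using assms(3,5)
proof (induction \<chi>E arbitrary: \<Phi>)
  case Nil
  then have "entails \<Phi> \<Psi>"
    by (auto simp: entails_def wp_runs_def)
  then show ?case
    \<comment> \<open>Both inner assertions are \<open>\<Psi>\<close>, so \<open>\<Phi>\<close> is
      only strengthened and need not be known to range over \<open>D\<close>.\<close>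
    by (rule fehl.Cons[OF assms(4) assms(4) _ _ fehl.Done]) (simp add: entails_def)
next
  case (Cons P \<chi>E)
  have "uht_valid L \<Phi> P (wp_runs L \<chi>E \<Psi>)"
    using Cons.prems(2) unfolding uht_valid_def entails_def wp_runs_def runs.simps by blast
  then have "UHT \<Phi> P (wp_runs L \<chi>E \<Psi>)"
    using assms(2) by (auto simp: uht_complete_def)
  moreover have "fehl L HT UHT D (wp_runs L \<chi>E \<Psi>) [] \<chi>E \<Psi>"
    using Cons.prems(1) by (intro Cons.IH) (auto simp: entails_def)
  moreover have "assertion_over D (wp_runs L \<chi>E \<Psi>)"
    using assms(1,4) Cons.prems(1) by (intro assertion_over_wp_runs) auto
  ultimately show ?case
    \<comment> \<open>Read backwards: \<open>P\<close> becomes \<open>P ;; Skip\<close>, the step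
      rule consumes \<open>P\<close>, and the remaining \<open>Skip\<close> is dropped.\<close>
    by (metis fehl.SkipEE fehl.StepE fehl.SkipIE)
qed

text \<open>The universal programs are consumed first, so that the existential outcomes may depend
  on theirs; the empty universal list is the case of \<open>fehl_existential\<close>.\<close>

lemma fehl_sequential:
  assumes "expr_lang L" "ht_complete L HT" "uht_complete L UHT"
    and "\<And>P. P \<in> set \<chi>A \<union> set \<chi>E \<Longrightarrow> prog_vars L P \<subseteq> D" "assertion_over D \<Psi>"
    and "entails \<Phi> (wlp_runs L \<chi>A (wp_runs L \<chi>E \<Psi>))"
  shows "fehl L HT UHT D \<Phi> \<chi>A \<chi>E \<Psi>"
  using assms(4,6)
proof (induction \<chi>A arbitrary: \<Phi>)
  case Nil
  then show ?case
    using assms by (intro fehl_existential) (auto simp: entails_def wlp_runs_def)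
next
  case (Cons P \<chi>A)
  let ?W = "wlp_runs L \<chi>A (wp_runs L \<chi>E \<Psi>)"
  have "ht_valid L \<Phi> P ?W"
    using Cons.prems(2) by (auto simp: ht_valid_def entails_def wlp_runs_def)
  then have "HT \<Phi> P ?W"
    using assms(2) by (auto simp: ht_complete_def)
  moreover have "fehl L HT UHT D ?W \<chi>A \<chi>E \<Psi>"
    using Cons.prems(1) by (intro Cons.IH) (auto simp: entails_def)
  moreover have "assertion_over D ?W"
    using assms(1,5) Cons.prems(1)
    by (intro assertion_over_wlp_runs assertion_over_wp_runs) auto
  ultimately show ?case
    by (metis fehl.SkipEA fehl.StepA fehl.SkipIA)
qed

section \<open>From validity of a tuple to its sequential form\<close>

lemma disjoint_family_vars_copy: "disjoint_family vars_copy"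
  by (auto simp: disjoint_family_on_def vars_copy_def)

text \<open>The universal run is projected to the copies, validity yields existential executions
  there, and these are glued into a run from \<open>\<sigma>'\<close>.\<close>

lemma feht_valid_sequential:
  fixes L :: "('v \<times> nat, 'e, 'b) lang"
  assumes L: "expr_lang L" and F: "is_feht L \<Phi> \<chi>A \<chi>E \<Psi>" and V: "feht_valid L \<Phi> \<chi>A \<chi>E \<Psi>"
  shows "entails \<Phi> (wlp_runs L \<chi>A (wp_runs L \<chi>E \<Psi>))"
  unfolding entails_def wlp_runs_def
proof (intro allI impI)
  fix \<sigma> \<sigma>' assume \<Phi>: "\<Phi> \<sigma>" and run: "runs L \<chi>A \<sigma> \<sigma>'"
  define k l where "k = length \<chi>A" and "l = length \<chi>E"
  define P where "P i = (\<chi>A @ \<chi>E) ! (i - 1)" for i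
  \<comment> \<open>The frame \<open>undefined\<close> makes each projection a member of
    \<open>states_on (vars_copy i)\<close>.\<close>
  let ?r = "\<lambda>\<sigma> i. override_on (\<lambda>_. undefined) \<sigma> (vars_copy i)"
  have over: "assertion_over (vars_upto (k + l)) \<Phi>" "assertion_over (vars_upto (k + l)) \<Psi>"
    and vars: "\<And>i. i \<in> {1..k + l} \<Longrightarrow> prog_vars L (P i) \<subseteq> vars_copy i"
    using F by (auto simp: is_feht_def Let_def k_def l_def P_def)
  have PA: "\<chi>A ! j = P (1 + j)" if "j < k" for j
    using that by (simp add: P_def k_def nth_append)
  have PE: "\<chi>E ! j = P (k + 1 + j)" if "j < l" for j
    using that by (simp add: P_def k_def nth_append)
  have in_states: "?r \<rho> i \<in> states_on (vars_copy i)" for \<rho> :: "('v \<times> nat) state" and i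
    by (auto simp: states_on_def override_on_def)
  have upto: "\<exists>i\<in>{1..k + l}. x \<in> vars_copy i" if "x \<in> vars_upto (k + l)" for x :: "'v \<times> nat"
    using that by (auto simp: vars_upto_def)
  have comb: "combine (k + l) \<tau> x = \<tau> i x" if "i \<in> {1..k + l}" "x \<in> vars_copy i"
    for \<tau> i and x :: "'v \<times> nat"
    using that by (auto simp: combine_def vars_upto_def vars_copy_def)
  \<comment> \<open>Outside \<open>vars_upto (k + l)\<close> the two states may differ;
    \<open>\<Phi>\<close> does not look there.\<close>
  have "\<forall>x\<in>vars_upto (k + l). \<sigma> x = combine (k + l) (?r \<sigma>) x"
    using upto comb by (metis override_on_apply_in)
  with \<Phi> over(1) have \<Phi>': "\<Phi> (combine (k + l) (?r \<sigma>))"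
    unfolding assertion_over_def by blast
  have sem: "sem L (P i) (?r \<sigma> i) (?r \<sigma>' i)" if "i \<in> {1..k}" for i
  proof -
    \<comment> \<open>Copies are numbered from 1 and list positions from 0, hence the offset
      \<open>m = 1\<close> here and \<open>m = k + 1\<close> for the existential list.\<close>
    have "sem L (\<chi>A ! (i - 1)) (?r \<sigma> (1 + (i - 1))) (?r \<sigma>' (1 + (i - 1)))"
      using that vars PA
      by (intro runs_components[OF L disjoint_family_vars_copy run]) (auto simp: k_def)
    with that PA[of "i - 1"] show ?thesis
      by auto
  qed
  obtain \<tau> where \<tau>: "\<And>i. i \<in> {k + 1..k + l} \<Longrightarrow> sem L (P i) (?r \<sigma> i) (\<tau> i)"
    "\<Psi> (combine (k + l) (\<lambda>i. if i \<le> k then ?r \<sigma>' i else \<tau> i))"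
    using V[unfolded feht_valid_def Let_def, folded k_def l_def P_def, rule_format,
        of "?r \<sigma>" "?r \<sigma>'"] in_states \<Phi>' sem by blast
  have copy: "i = j" if "x \<in> vars_copy i" "x \<in> vars_copy j" for x :: "'v \<times> nat" and i j
    using that by (auto simp: vars_copy_def)
  have A_frame: "\<sigma>' x = \<sigma> x" if x: "x \<in> vars_copy i" "i > k" for x i
  proof (rule runs_unmodified[OF run])
    fix Q assume "Q \<in> set \<chi>A"
    then obtain j where j: "j < k" "Q = P (1 + j)"
      using PA by (metis in_set_conv_nth k_def)
    with vars[of "1 + j"] have "prog_vars L Q \<subseteq> vars_copy (1 + j)"
      by auto
    with copy[OF x(1), of "1 + j"] x(2) j(1) show "x \<notin> prog_vars L Q"
      by auto
  qed
  \<comment> \<open>Validity gives existential executions from \<open>\<sigma>\<close>; as the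
    universal run leaves their copies alone, they also start from \<open>\<sigma>'\<close>.\<close>
  have same: "?r \<sigma>' i = ?r \<sigma> i" if "i > k" for i
    using A_frame[of _ i] that by (auto simp: override_on_def)
  have "\<exists>\<sigma>''. runs L \<chi>E \<sigma>' \<sigma>'' \<and>
      (\<forall>j<length \<chi>E. \<forall>x\<in>vars_copy (k + 1 + j). \<sigma>'' x = \<tau> (k + 1 + j) x)"
  proof (rule runs_of_components[OF L disjoint_family_vars_copy])
    fix j assume "j < length \<chi>E"
    then show "prog_vars L (\<chi>E ! j) \<subseteq> vars_copy (k + 1 + j)"
      and "sem L (\<chi>E ! j) (?r \<sigma>' (k + 1 + j)) (\<tau> (k + 1 + j))"
      using vars[of "k + 1 + j"] \<tau>(1)[of "k + 1 + j"] PE[of j] same[of "k + 1 + j"]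
      by (auto simp: l_def)
  qed
  then obtain \<sigma>'' where \<sigma>'': "runs L \<chi>E \<sigma>' \<sigma>''"
    "\<And>j x. j < l \<Longrightarrow> x \<in> vars_copy (k + 1 + j) \<Longrightarrow> \<sigma>'' x = \<tau> (k + 1 + j) x"
    by (auto simp: l_def)
  have E_frame: "\<sigma>'' x = \<sigma>' x" if x: "x \<in> vars_copy i" "i \<le> k" for x i
  proof (rule runs_unmodified[OF \<sigma>''(1)])
    fix Q assume "Q \<in> set \<chi>E"
    then obtain j where j: "j < l" "Q = P (k + 1 + j)"
      using PE by (metis in_set_conv_nth l_def)
    with vars[of "k + 1 + j"] have "prog_vars L Q \<subseteq> vars_copy (k + 1 + j)"
      by auto
    with copy[OF x(1), of "k + 1 + j"] x(2) j(1) show "x \<notin> prog_vars L Q"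
      by auto
  qed
  have "\<sigma>'' x = combine (k + l) (\<lambda>i. if i \<le> k then ?r \<sigma>' i else \<tau> i) x"
    if "x \<in> vars_upto (k + l)" for x
  proof -
    from upto[OF that] obtain i where i: "i \<in> {1..k + l}" "x \<in> vars_copy i"
      by blast
    show ?thesis
      \<comment> \<open>For \<open>i \<le> k\<close> the existential run preserves the value in
        \<open>\<sigma>'\<close>; for larger \<open>i\<close> the value is that of
        \<open>\<tau> i\<close>, at list position \<open>i - (k + 1)\<close>.\<close>
      using E_frame[OF i(2)] \<sigma>''(2)[of "i - (k + 1)" x] i by (auto simp: comb[OF i])
  qed
  with \<tau>(2) over(2) have "\<Psi> \<sigma>''"
    unfolding assertion_over_def by blast
  with \<sigma>''(1) show "wp_runs L \<chi>E \<Psi> \<sigma>'"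
    by (auto simp: wp_runs_def)
qed

theorem theorem2:
  fixes L :: "('v \<times> nat, 'e, 'b) lang"
    and HT UHT :: "('v \<times> nat, 'e, 'b) triple_system"
    and \<Phi> \<Psi> :: "('v \<times> nat) assertion"
    and \<chi>A \<chi>E :: "('v \<times> nat, 'e, 'b) prog list"
  assumes "expr_lang L"
    and "ht_complete L HT"
    and "uht_complete L UHT"
    and "is_feht L \<Phi> \<chi>A \<chi>E \<Psi>"
    and "feht_valid L \<Phi> \<chi>A \<chi>E \<Psi>"
  shows "fehl L HT UHT (vars_upto (length \<chi>A + length \<chi>E)) \<Phi> \<chi>A \<chi>E \<Psi>"
proof (rule fehl_sequential[OF assms(1-3)])
  fix P assume "P \<in> set \<chi>A \<union> set \<chi>E"
  then have "P \<in> set (\<chi>A @ \<chi>E)"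
    by simp
  then obtain j where "j < length \<chi>A + length \<chi>E" "P = (\<chi>A @ \<chi>E) ! j"
    by (metis in_set_conv_nth length_append)
  \<comment> \<open>List position \<open>j\<close> is rewritten to the index \<open>Suc j\<close>,
    the form in which \<open>is_feht\<close> bounds the variables of \<open>P\<close>.\<close>
  then have "Suc j \<in> {1..length \<chi>A + length \<chi>E}" "P = (\<chi>A @ \<chi>E) ! (Suc j - 1)"
    by auto
  with assms(4) show "prog_vars L P \<subseteq> vars_upto (length \<chi>A + length \<chi>E)"
    unfolding is_feht_def Let_def vars_upto_def by blast
next
  show "assertion_over (vars_upto (length \<chi>A + length \<chi>E)) \<Psi>"
    using assms(4) by (auto simp: is_feht_def Let_def)
  show "entails \<Phi> (wlp_runs L \<chi>A (wp_runs L \<chi>E \<Psi>))"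
    by (rule feht_valid_sequential[OF assms(1,4,5)])
qed

end
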